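(* We have $$s(2^4\cdot5^2)\,l^\infty\sim s(2^5\cdot5^3)\,l^\infty$$ for all primes $l$. Any other solution $(p,q,l,k,r)$, $p\le q$, of $$s(p^kq^r)\,l^\infty\sim s(p^{k+1}q^{r+1})\,l^\infty$$ gives a counterexample to the Goormaghtigh conjecture.
   Context: Here $p,q,l$ denote primes and $k,r$ natural numbers. Let $\widehat{\mathbb{Z}}=\prod_p\mathbb{Z}_p$ be the profinite integers and $\mathbb{A}_f=\widehat{\mathbb{Z}}\otimes\mathbb{Q}$ the finite adeles. For a natural number $n$, $s(n)\in\widehat{\mathbb{Z}}$ is the element whose component at each prime $p$ is the largest power of $p$ dividing $n$ (with $s(0)=0$). For a prime $l$, $l^\infty\in\widehat{\mathbb{Z}}$ is the element whose $l$-th component is $0$ and whose component at every other prime is $1$. Products are taken in $\widehat{\mathbb{Z}}$. For $z,z'\in\widehat{\mathbb{Z}}$, write $z'\sim z$ if there is $\begin{pmatrix}a&b\\c&d\end{pmatrix}\in\mathrm{PGL}_2(\mathbb{Q})$ with $a+cz\in\mathbb{A}_f^\times$ and $z'=\frac{b+dz}{a+cz}$. Equivalently, the extensions of $\mathbb{Q}$ by $\mathbb{Z}$ corresponding to $z$ and $z'$ under $\mathrm{Ext}^1(\mathbb{Q},\mathbb{Z})=\mathbb{A}_f/\mathbb{Q}$ are isomorphic as abelian groups. The Goormaghtigh conjecture states that the only natural number solutions to $$\frac{x^n-1}{x-1}=\frac{y^m-1}{y-1}$$ are $(x,y,n,m)=(2,5,5,3)$ and $(x,y,n,m)=(2,9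0,13,3)$.
   Formalization: The second sentence is proved for pairwise distinct p, q, l; without this it fails, e.g. s(2·3)·2^∞ ~ s(2²·3²)·2^∞ and s(2)·3^∞ ~ s(2³)·3^∞ are solutions that give no Goormaghtigh counterexample. *)

theory Defs
  imports Complex_Main "HOL-Library.FuncSet" "HOL-Computational_Algebra.Primes" "HOL-Number_Theory.Cong"
begin

(* Z_p as the inverse limit of the rings Z/p^n: a p-adic integer is the coherent
   sequence of its canonical residues modulo p^n. *)
definition padic_ints :: "nat \<Rightarrow> (nat \<Rightarrow> int) set" where
  "padic_ints p = {x. \<forall>n. x n \<in> {0..<int p ^ n} \<and> x (Suc n) mod int p ^ n = x n}"

abbreviation primes :: "nat set" where
  "primes \<equiv> {p. prime p}"

definition padic_reduce :: "nat \<Rightarrow> (nat \<Rightarrow> int) \<Rightarrow> nat \<Rightarrow> int" where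
  "padic_reduce p x = (\<lambda>n. x n mod int p ^ n)"

lemma padic_reduceI:
  assumes "p > 0" "\<And>n. [x (Suc n) = x n] (mod int p ^ n)"
  shows "padic_reduce p x \<in> padic_ints p"
proof -
  have "x (Suc n) mod int p ^ Suc n mod int p ^ n = x n mod int p ^ n" for n
    using assms(2)[of n] by (simp add: mod_mod_cancel cong_def)
  then show ?thesis using assms(1) by (simp add: padic_ints_def padic_reduce_def)
qed

lemma padic_ints_cong: "x \<in> padic_ints p \<Longrightarrow> [x (Suc n) = x n] (mod int p ^ n)"
  by (auto simp: padic_ints_def cong_def)

lemma PiE_padic_ints_cong:
  "x \<in> (\<Pi>\<^sub>E p\<in>primes. padic_ints p) \<Longrightarrow> prime p \<Longrightarrow> [x p (Suc n) = x p n] (mod int p ^ n)"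
  by (rule padic_ints_cong) auto

typedef profinite_int = "\<Pi>\<^sub>E p\<in>primes. padic_ints p"
  morphisms component Abs_profinite_int
proof -
  have "(\<lambda>p\<in>primes. \<lambda>n. 0) \<in> (\<Pi>\<^sub>E p\<in>primes. padic_ints p)"
    by (auto simp: padic_ints_def prime_gt_0_nat)
  then show ?thesis by blast
qed

setup_lifting type_definition_profinite_int

lemma component_in: "prime p \<Longrightarrow> component z p \<in> padic_ints p"
  using component[of z] by auto

lemma component_mod: "prime p \<Longrightarrow> component z p n mod int p ^ n = component z p n"
  using component_in[of p z] by (auto simp: padic_ints_def)

lemma component_cong: "prime p \<Longrightarrow> [component z p (Suc n) = component z p n] (mod int p ^ n)"
  by (rule padic_ints_cong[OF component_in])

lemma profinite_int_eqI:
  assumes "\<And>p n. prime p \<Longrightarrow> component x p n = component y p n"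
  shows "x = y"
proof -
  have "component x = component y"
    using component[of x] component[of y] assms by (intro PiE_ext) auto
  then show ?thesis by (simp add: component_inject)
qed

(* the element of the product whose p-th component is the rational integer f p *)
lift_definition of_int_components :: "(nat \<Rightarrow> int) \<Rightarrow> profinite_int" is
  "\<lambda>f. \<lambda>p\<in>primes. padic_reduce p (\<lambda>n. f p)"
  by (auto intro!: padic_reduceI simp: prime_gt_0_nat)

instantiation profinite_int :: comm_ring_1
begin

definition zero_profinite_int :: profinite_int where
  "0 = of_int_components (\<lambda>p. 0)"

definition one_profinite_int :: profinite_int where
  "1 = of_int_components (\<lambda>p. 1)"

lift_definition plus_profinite_int :: "profinite_int \<Rightarrow> profinite_int \<Rightarrow> profinite_int" is
  "\<lambda>x y. \<lambda>p\<in>primes. padic_reduce p (\<lambda>n. x p n + y p n)"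
  by (auto intro!: padic_reduceI cong_add simp: PiE_padic_ints_cong prime_gt_0_nat)

lift_definition times_profinite_int :: "profinite_int \<Rightarrow> profinite_int \<Rightarrow> profinite_int" is
  "\<lambda>x y. \<lambda>p\<in>primes. padic_reduce p (\<lambda>n. x p n * y p n)"
  by (auto intro!: padic_reduceI cong_mult simp: PiE_padic_ints_cong prime_gt_0_nat)

lift_definition uminus_profinite_int :: "profinite_int \<Rightarrow> profinite_int" is
  "\<lambda>x. \<lambda>p\<in>primes. padic_reduce p (\<lambda>n. - x p n)"
  by (auto intro!: padic_reduceI simp: PiE_padic_ints_cong prime_gt_0_nat cong_minus_minus_iff)

definition minus_profinite_int :: "profinite_int \<Rightarrow> profinite_int \<Rightarrow> profinite_int" where
  "x - y = x + (- y :: profinite_int)"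

lemma component_of_int_components:
  "prime p \<Longrightarrow> component (of_int_components f) p n = f p mod int p ^ n"
  by transfer (simp add: padic_reduce_def)

lemma component_plus:
  "prime p \<Longrightarrow> component (x + y) p n = (component x p n + component y p n) mod int p ^ n"
  by transfer (simp add: padic_reduce_def)

lemma component_times:
  "prime p \<Longrightarrow> component (x * y) p n = (component x p n * component y p n) mod int p ^ n"
  by transfer (simp add: padic_reduce_def)

lemma component_uminus:
  "prime p \<Longrightarrow> component (- x) p n = (- component x p n) mod int p ^ n"
  by transfer (simp add: padic_reduce_def)

lemma component_minus:
  "prime p \<Longrightarrow> component (x - y) p n = (component x p n - component y p n) mod int p ^ n"
  by (simp add: minus_profinite_int_def component_plus component_uminus mod_simps)

lemma component_zero: "prime p \<Longrightarrow> component 0 p n = 0"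
  by (simp add: zero_profinite_int_def component_of_int_components)

lemma component_one: "prime p \<Longrightarrow> component 1 p n = 1 mod int p ^ n"
  by (simp add: one_profinite_int_def component_of_int_components)

lemmas component_simps = component_of_int_components component_plus component_times
  component_uminus component_minus component_zero component_one

instance
proof
  fix a b c :: profinite_int
  show "a * b * c = a * (b * c)"
    by (rule profinite_int_eqI) (simp add: component_simps mod_simps mult.assoc)
  show "a * b = b * a"
    by (rule profinite_int_eqI) (simp add: component_simps mult.commute)
  show "1 * a = a"
    by (rule profinite_int_eqI) (simp add: component_simps mod_simps component_mod)
  show "a + b + c = a + (b + c)"
    by (rule profinite_int_eqI) (simp add: component_simps mod_simps add.assoc)
  show "a + b = b + a"
    by (rule profinite_int_eqI) (simp add: component_simps add.commute)
  show "0 + a = a"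
    by (rule profinite_int_eqI) (simp add: component_simps component_mod)
  show "- a + a = 0"
    by (rule profinite_int_eqI) (simp add: component_simps mod_simps)
  show "a - b = a + - b"
    by (simp add: minus_profinite_int_def)
  show "(a + b) * c = a * c + b * c"
    by (rule profinite_int_eqI) (simp add: component_simps mod_simps algebra_simps)
  have "component 0 2 1 \<noteq> component 1 2 1"
    by (simp add: component_simps)
  then show "(0::profinite_int) \<noteq> 1" by metis
qed

end

lemma of_int_profinite_int: "of_int m = of_int_components (\<lambda>p. m)"
proof (induction m rule: int_induct[where k = 0])
  case base
  then show ?case by (simp add: zero_profinite_int_def)
next
  case (step1 i)
  then show ?case
    by (auto intro!: profinite_int_eqI simp: component_simps mod_simps)
next
  case (step2 i)
  then show ?case
    by (auto intro!: profinite_int_eqI simp: component_simps mod_simps)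
qed

lemma profinite_int_torsion_free:
  assumes "of_int m * x = (0::profinite_int)" "m \<noteq> 0"
  shows "x = 0"
proof (rule profinite_int_eqI)
  fix p n :: nat assume p: "prime p"
  define v where "v = multiplicity (int p) m"
  have "component (of_int m * x) p (n + v) = 0"
    unfolding assms(1) using p by (rule component_zero)
  then have d: "int p ^ (n + v) dvd m * component x p (n + v)"
    using p by (simp add: of_int_profinite_int component_simps mod_simps mod_eq_0_iff_dvd)
  have "\<not> is_unit (int p)"
    using prime_gt_1_nat[OF p] by simp
  then obtain u where u: "m = int p ^ v * u" "\<not> int p dvd u"
    unfolding v_def by (rule multiplicity_decompose'[OF assms(2)])
  have "int p ^ v * int p ^ n dvd int p ^ v * (u * component x p (n + v))"
    using d by (subst (asm) u(1)) (simp only: power_add mult_ac)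
  then have "int p ^ n dvd u * component x p (n + v)"
    using prime_gt_0_nat[OF p] by (subst (asm) dvd_mult_cancel_left) simp
  moreover have "coprime (int p ^ n) u"
    using prime_imp_coprime[OF _ u(2)] p by (intro coprime_power_left_iff[THEN iffD2] disjI1) simp
  ultimately have *: "int p ^ n dvd component x p (n + v)"
    by (simp add: coprime_dvd_mult_right_iff)
  have "[component x p (n + j) = component x p n] (mod int p ^ n)" for j
  proof (induction j)
    case (Suc j)
    have "[component x p (Suc (n + j)) = component x p (n + j)] (mod int p ^ n)"
      using component_cong[OF p, of x "n + j"] by (rule cong_dvd_modulus) (simp add: power_add)
    from cong_trans[OF this Suc] show ?case unfolding add_Suc_right .
  qed simp
  from cong_dvd_iff[OF this[of v]] * have "component x p n mod int p ^ n = 0"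
    by (simp only: dvd_imp_mod_0)
  then show "component x p n = component 0 p n"
    using p by (simp add: component_mod component_zero)
qed

(* The tensor product of the profinite integers with Q is their localization at the
   nonzero rational integers; (x, m) represents x / m. No cancelling factor is needed
   in the relation because the profinite integers are torsion free. *)
definition adele_rel :: "profinite_int \<times> int \<Rightarrow> profinite_int \<times> int \<Rightarrow> bool" where
  "adele_rel = (\<lambda>(x, m) (y, n). m \<noteq> 0 \<and> n \<noteq> 0 \<and> x * of_int n = y * of_int m)"

lemma part_equivp_adele_rel: "part_equivp adele_rel"
proof (rule part_equivpI)
  show "\<exists>u. adele_rel u u"
    by (rule exI[of _ "(0, 1)"]) (simp add: adele_rel_def)
  show "symp adele_rel"
    by (auto simp: symp_def adele_rel_def)
  show "transp adele_rel"
  proof (rule transpI, clarify)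
    fix x y z :: profinite_int and k m n :: int
    assume "adele_rel (x, k) (y, m)" "adele_rel (y, m) (z, n)"
    then have nz: "k \<noteq> 0" "m \<noteq> 0" "n \<noteq> 0"
      and e: "x * of_int m = y * of_int k" "y * of_int n = z * of_int m"
      by (auto simp: adele_rel_def)
    have "of_int m * (x * of_int n) = of_int n * (x * of_int m)" by (simp only: mult_ac)
    also have "\<dots> = of_int k * (y * of_int n)" by (simp only: e(1) mult_ac)
    also have "\<dots> = of_int m * (z * of_int k)" by (simp only: e(2) mult_ac)
    finally have "of_int m * (x * of_int n - z * of_int k) = 0"
      by (simp add: right_diff_distrib)
    from profinite_int_torsion_free[OF this nz(2)] show "adele_rel (x, k) (z, n)"
      using nz by (simp add: adele_rel_def)
  qed
qed

quotient_type finite_adele = "profinite_int \<times> int" / partial: adele_rel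
  by (rule part_equivp_adele_rel)

instantiation finite_adele :: comm_ring_1
begin

lift_definition zero_finite_adele :: finite_adele is "(0, 1)"
  by (simp add: adele_rel_def)

lift_definition one_finite_adele :: finite_adele is "(1, 1)"
  by (simp add: adele_rel_def)

lift_definition plus_finite_adele :: "finite_adele \<Rightarrow> finite_adele \<Rightarrow> finite_adele" is
  "\<lambda>(x, m) (y, n). (x * of_int n + y * of_int m, m * n)"
proof (clarsimp simp: adele_rel_def)
  fix x y x' y' :: profinite_int and m n m' n' :: int
  assume e: "x * of_int m' = x' * of_int m" "y * of_int n' = y' * of_int n"
  have "(x * of_int n + y * of_int m) * (of_int m' * of_int n') =
      (x * of_int m') * (of_int n * of_int n') + (y * of_int n') * (of_int m * of_int m')"
    by (simp add: algebra_simps)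
  also have "\<dots> = (x' * of_int n' + y' * of_int m') * (of_int m * of_int n)"
    unfolding e by (simp add: algebra_simps)
  finally show "(x * of_int n + y * of_int m) * (of_int m' * of_int n') =
    (x' * of_int n' + y' * of_int m') * (of_int m * of_int n)" .
qed

lift_definition times_finite_adele :: "finite_adele \<Rightarrow> finite_adele \<Rightarrow> finite_adele" is
  "\<lambda>(x, m) (y, n). (x * y, m * n)"
proof (clarsimp simp: adele_rel_def)
  fix x y x' y' :: profinite_int and m n m' n' :: int
  assume e: "x * of_int m' = x' * of_int m" "y * of_int n' = y' * of_int n"
  have "x * y * (of_int m' * of_int n') = (x * of_int m') * (y * of_int n')"
    by (simp only: mult_ac)
  also have "\<dots> = x' * y' * (of_int m * of_int n)"
    unfolding e by (simp only: mult_ac)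
  finally show "x * y * (of_int m' * of_int n') = x' * y' * (of_int m * of_int n)" .
qed

lift_definition uminus_finite_adele :: "finite_adele \<Rightarrow> finite_adele" is
  "\<lambda>(x, m). (- x, m)"
  by (auto simp: adele_rel_def)

definition minus_finite_adele :: "finite_adele \<Rightarrow> finite_adele \<Rightarrow> finite_adele" where
  "x - y = x + (- y :: finite_adele)"

instance
proof
  fix a b c :: finite_adele
  show "a * b * c = a * (b * c)"
    by transfer (auto simp: adele_rel_def algebra_simps)
  show "a * b = b * a"
    by transfer (auto simp: adele_rel_def algebra_simps)
  show "1 * a = a"
    by transfer (auto simp: adele_rel_def algebra_simps)
  show "a + b + c = a + (b + c)"
    by transfer (auto simp: adele_rel_def algebra_simps)
  show "a + b = b + a"
    by transfer (auto simp: adele_rel_def algebra_simps)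
  show "0 + a = a"
    by transfer (auto simp: adele_rel_def algebra_simps)
  show "- a + a = 0"
    by transfer (auto simp: adele_rel_def algebra_simps)
  show "a - b = a + - b"
    by (simp add: minus_finite_adele_def)
  show "(a + b) * c = a * c + b * c"
    by transfer (auto simp: adele_rel_def algebra_simps)
  show "(0::finite_adele) \<noteq> 1"
    by transfer (simp add: adele_rel_def)
qed

end

(* only meaningful for invertible adeles; 0 on all other elements *)
instantiation finite_adele :: inverse
begin

definition inverse_finite_adele :: "finite_adele \<Rightarrow> finite_adele" where
  "inverse (x :: finite_adele) = (if x dvd 1 then THE y. x * y = 1 else 0)"

definition divide_finite_adele :: "finite_adele \<Rightarrow> finite_adele \<Rightarrow> finite_adele" where
  "x div y = x * inverse (y :: finite_adele)"

instance ..

end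

lifting_forget profinite_int.lifting

lift_definition adele_of :: "profinite_int \<Rightarrow> finite_adele" is "\<lambda>z. (z, 1)"
  by (simp add: adele_rel_def)

(* quotient_of a is the reduced fraction of a, with positive denominator *)
lift_definition adele_of_rat :: "rat \<Rightarrow> finite_adele" is
  "\<lambda>a. (of_int (fst (quotient_of a)), snd (quotient_of a))"
  subgoal for a using quotient_of_denom_pos'[of a] by (simp add: adele_rel_def)
  done

(* An element of PGL_2(Q) is given by an invertible matrix with rational entries; the
   conditions below are unchanged when a, b, c, d are multiplied by a common nonzero
   rational. *)
definition profinite_sim :: "profinite_int \<Rightarrow> profinite_int \<Rightarrow> bool" (infix "\<sim>\<^sub>Z" 50) where
  "z' \<sim>\<^sub>Z z \<longleftrightarrow> (\<exists>a b c d :: rat. a * d - b * c \<noteq> 0 \<and>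
     adele_of_rat a + adele_of_rat c * adele_of z dvd 1 \<and>
     adele_of z' = (adele_of_rat b + adele_of_rat d * adele_of z) /
                   (adele_of_rat a + adele_of_rat c * adele_of z))"

definition supernat :: "nat \<Rightarrow> profinite_int" where
  "supernat n = (if n = 0 then 0 else of_int_components (\<lambda>p. int (p ^ multiplicity p n)))"

definition prime_infty :: "nat \<Rightarrow> profinite_int" where
  "prime_infty l = of_int_components (\<lambda>p. if p = l then 0 else 1)"

(* The usual side conditions 1 < x < y and n, m > 2 are implicit in the conjecture:
   without them there are trivial solutions (x = y, or m = 2 and y determined by x, n). *)
definition goormaghtigh_solution :: "nat \<Rightarrow> nat \<Rightarrow> nat \<Rightarrow> nat \<Rightarrow> bool" where
  "goormaghtigh_solution x y n m \<longleftrightarrow> 1 < x \<and> x < y \<and> 2 < n \<and> 2 < m \<and>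
     (rat_of_nat x ^ n - 1) / (rat_of_nat x - 1) = (rat_of_nat y ^ m - 1) / (rat_of_nat y - 1)"

definition goormaghtigh_counterexample :: "nat \<Rightarrow> nat \<Rightarrow> nat \<Rightarrow> nat \<Rightarrow> bool" where
  "goormaghtigh_counterexample x y n m \<longleftrightarrow> goormaghtigh_solution x y n m \<and>
     (x, y, n, m) \<notin> {(2, 5, 5, 3), (2, 90, 13, 3)}"

end

theory Submission
  imports Defs
begin

text \<open>
  Both sides of the relation are profinite integers whose component at every prime is a
  rational integer. For such elements the relation is a system of integer equations: after
  clearing denominators in the matrix, \<open>z'(a + cz) = b + dz\<close> holds in the adeles iff it holds
  at each prime, and there it is an identity between integers.

  Let \<open>z'\<close> and \<open>z\<close> have components \<open>p^k, q^r\<close> and \<open>p^(k+1), q^(r+1)\<close> at \<open>p\<close> and \<open>q\<close>, both \<open>0\<close> at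
  \<open>l\<close>, and both \<open>1\<close> at every other prime. The prime \<open>l\<close> gives \<open>b = 0\<close>, so that \<open>a\<close> and \<open>d\<close> are
  nonzero; a prime outside \<open>{p, q, l}\<close> gives \<open>d = a + c\<close>; and then \<open>p\<close> and \<open>q\<close> give
  \[ c (1 + p + \dots + p^k) = d = c (1 + q + \dots + q^r). \]
  As \<open>d \<noteq> 0\<close> implies \<open>c \<noteq> 0\<close>, the two geometric sums have the same value \<open>d / c\<close>, which is not \<open>1\<close>
  because \<open>a \<noteq> 0\<close>. Hence \<open>k\<close> and \<open>r\<close> are positive. Neither of them is \<open>1\<close>: if \<open>r = 1\<close>, then
  \<open>q = p + \<dots> + p^k\<close> is a prime divisible by \<open>p\<close>. So the common value is a solution of the
  Goormaghtigh equation, and it is neither of the known ones, as \<open>90\<close> is not prime.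

  In the other direction, \<open>1 + 2 + \<dots> + 2^4 = 31 = 1 + 5 + 5^2\<close> leads to the matrix with
  \<open>a = 30\<close>, \<open>b = 0\<close>, \<open>c = 1\<close>, \<open>d = 31\<close>.
\<close>

section \<open>Profinite integers with rational integer components\<close>

lemma of_int_components_times:
  "of_int_components f * of_int_components g = of_int_components (\<lambda>p. f p * g p)"
  by (rule profinite_int_eqI) (simp add: component_simps mod_simps)

lemma of_int_components_plus:
  "of_int_components f + of_int_components g = of_int_components (\<lambda>p. f p + g p)"
  by (rule profinite_int_eqI) (simp add: component_simps mod_simps)

lemmas of_int_components_arith =
  of_int_profinite_int of_int_components_times of_int_components_plus

text \<open>
  An integer divisible by all powers of \<open>p\<close> is zero, so the integers embed into the \<open>p\<close>-adic
  integers.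
\<close>
lemma of_int_components_eq_iff:
  "of_int_components f = of_int_components g \<longleftrightarrow> (\<forall>p. prime p \<longrightarrow> f p = g p)"
proof (intro iffI allI impI)
  fix p :: nat
  assume eq: "of_int_components f = of_int_components g" and p: "prime p"
  define n where "n = nat \<bar>f p - g p\<bar>"
  have "component (of_int_components f) p n = component (of_int_components g) p n"
    by (simp only: eq)
  then have dvd: "int p ^ n dvd f p - g p"
    using p by (simp add: component_of_int_components mod_eq_dvd_iff)
  have "n < p ^ n"
    using power_gt_expt[of p n] prime_gt_1_nat[OF p] by simp
  then have "\<bar>f p - g p\<bar> < int p ^ n"
    unfolding n_def by (metis nat_less_iff abs_ge_zero of_nat_power)
  then show "f p = g p"
    using dvd_imp_le_int[OF _ dvd] by fastforce
next
  assume "\<forall>p. prime p \<longrightarrow> f p = g p"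
  then show "of_int_components f = of_int_components g"
    by (intro profinite_int_eqI) (simp add: component_of_int_components)
qed

lemma supernat_times_prime_infty:
  assumes "n \<noteq> 0"
  shows "supernat n * prime_infty l =
    of_int_components (\<lambda>p. if p = l then 0 else int p ^ multiplicity p n)"
  using assms by (auto simp: supernat_def prime_infty_def of_int_components_times
      of_int_components_eq_iff)

lemma multiplicity_two_prime_powers:
  fixes p q t :: nat
  assumes "prime p" "prime q" "prime t" "p \<noteq> q"
  shows "multiplicity t (p ^ k * q ^ r) = (if t = p then k else if t = q then r else 0)"
  using assms
  by (auto simp: prime_elem_multiplicity_mult_distrib prime_elem_multiplicity_power_distrib
      prime_multiplicity_other)


section \<open>Arithmetic of finite adeles\<close>

lemma adele_of_inject: "adele_of x = adele_of y \<longleftrightarrow> x = y"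
  by transfer (simp add: adele_rel_def)

lemma adele_of_plus: "adele_of (x + y) = adele_of x + adele_of y"
  by transfer (simp add: adele_rel_def)

lemma adele_of_times: "adele_of (x * y) = adele_of x * adele_of y"
  by transfer (simp add: adele_rel_def)

lemma adele_of_one: "adele_of 1 = 1"
  by transfer (simp add: adele_rel_def)

lemma adele_of_int_times_rat:
  assumes "of_int m * a = (of_int n :: rat)"
  shows "adele_of (of_int m) * adele_of_rat a = adele_of (of_int n)"
proof -
  obtain u v where uv: "quotient_of a = (u, v)"
    by (cases "quotient_of a")
  have v: "v > 0" using uv by (rule quotient_of_denom_pos)
  have "a = of_int u / of_int v" using uv by (rule quotient_of_div)
  with assms v have "(of_int (m * u) :: rat) = of_int (n * v)"
    by (simp add: field_simps)
  then have "m * u = n * v"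
    by (simp only: of_int_eq_iff)
  then have "(of_int (m * u) :: profinite_int) = of_int (n * v)"
    by simp
  with uv v show ?thesis
    by transfer (simp add: adele_rel_def)
qed

lemma adele_of_rat_of_int: "adele_of_rat (of_int n) = adele_of (of_int n)"
  using adele_of_int_times_rat[of 1 "of_int n" n] by (simp add: adele_of_one)

lemma adele_of_int_dvd_one:
  assumes "n \<noteq> 0"
  shows "adele_of (of_int n) dvd 1"
  using adele_of_int_times_rat[of n "1 / of_int n" 1] assms
  by (auto simp: adele_of_one intro: dvdI[OF sym])

lemma adele_eq_divide_iff:
  fixes x y w :: finite_adele
  assumes "y dvd 1"
  shows "w = x / y \<longleftrightarrow> w * y = x"
proof -
  obtain v where v: "y * v = 1" using assms by (auto simp: dvd_def)
  have "(THE u. y * u = 1) = v"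
  proof (rule the_equality)
    fix u assume u: "y * u = 1"
    have "u = (y * v) * u" by (simp add: v)
    also have "\<dots> = v" using u by (metis mult.assoc mult.commute mult.right_neutral)
    finally show "u = v" .
  qed (fact v)
  then have d: "x / y = x * v"
    using assms by (simp add: divide_finite_adele_def inverse_finite_adele_def)
  show ?thesis
  proof
    assume "w = x / y"
    then have "w * y = x * (y * v)" by (simp add: d mult_ac)
    then show "w * y = x" by (simp add: v)
  next
    assume "w * y = x"
    then have "x * v = w * (y * v)" by (simp add: mult_ac)
    then show "w = x / y" by (simp add: d v)
  qed
qed


section \<open>The relation as a system of integer equations\<close>

lemma common_denominator4:
  fixes a b c d :: rat
  obtains m A B C D :: int where "m \<noteq> 0" "of_int m * a = of_int A" "of_int m * b = of_int B"
    "of_int m * c = of_int C" "of_int m * d = of_int D"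
proof -
  have frac: "\<exists>u v. v \<noteq> 0 \<and> x = of_int u / of_int v" for x :: rat
    by (metis quotient_of_div quotient_of_denom_pos less_irrefl surj_pair)
  obtain a1 a2 b1 b2 c1 c2 d1 d2 where
    nz: "a2 \<noteq> 0" "b2 \<noteq> 0" "c2 \<noteq> 0" "d2 \<noteq> 0" and
    eq: "a = of_int a1 / of_int a2" "b = of_int b1 / of_int b2"
      "c = of_int c1 / of_int c2" "d = of_int d1 / of_int d2"
    using frac[of a] frac[of b] frac[of c] frac[of d] by metis
  show thesis
    by (rule that[of "a2 * b2 * c2 * d2" "a1 * b2 * c2 * d2" "a2 * b1 * c2 * d2"
          "a2 * b2 * c1 * d2" "a2 * b2 * c2 * d1"]) (use nz in \<open>simp_all add: eq\<close>)
qed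

text \<open>
  The matrix only matters up to a scalar, so it can be taken integral; the equation between
  adeles then lies in the profinite integers, where it can be compared prime by prime.
\<close>
lemma profinite_sim_of_int_componentsD:
  assumes "of_int_components f \<sim>\<^sub>Z of_int_components g"
  obtains A B C D :: int where "A * D - B * C \<noteq> 0"
    "\<And>p. prime p \<Longrightarrow> f p * (A + C * g p) = B + D * g p"
proof -
  define z' z where "z' = of_int_components f" and "z = of_int_components g"
  obtain a b c d where det: "a * d - b * c \<noteq> 0"
    and unit: "adele_of_rat a + adele_of_rat c * adele_of z dvd 1"
    and div: "adele_of z' = (adele_of_rat b + adele_of_rat d * adele_of z) /
                   (adele_of_rat a + adele_of_rat c * adele_of z)"
    using assms unfolding profinite_sim_def z_def z'_def by blast
  obtain m A B C D where m: "m \<noteq> 0" and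
    abcd: "of_int m * a = of_int A" "of_int m * b = of_int B"
      "of_int m * c = of_int C" "of_int m * d = of_int D"
    by (rule common_denominator4)
  note scale = abcd[THEN adele_of_int_times_rat]
  have eq: "adele_of z' * (adele_of_rat a + adele_of_rat c * adele_of z) =
      adele_of_rat b + adele_of_rat d * adele_of z"
    using div by (simp only: adele_eq_divide_iff[OF unit])
  let ?m = "adele_of (of_int m)"
  have "adele_of (z' * (of_int A + of_int C * z)) =
      ?m * (adele_of z' * (adele_of_rat a + adele_of_rat c * adele_of z))"
    by (simp add: adele_of_plus adele_of_times scale[symmetric] algebra_simps)
  also have "\<dots> = adele_of (of_int B + of_int D * z)"
    unfolding eq by (simp add: adele_of_plus adele_of_times scale[symmetric] algebra_simps)
  finally have "z' * (of_int A + of_int C * z) = of_int B + of_int D * z"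
    by (simp only: adele_of_inject)
  then have "\<And>p. prime p \<Longrightarrow> f p * (A + C * g p) = B + D * g p"
    by (simp add: z_def z'_def of_int_components_arith of_int_components_eq_iff)
  moreover have "(of_int (A * D - B * C) :: rat) = of_int m * of_int m * (a * d - b * c)"
    by (simp add: abcd[symmetric] algebra_simps)
  with m det have "A * D - B * C \<noteq> 0"
    by (metis mult_eq_0_iff of_int_0 of_int_eq_0_iff)
  ultimately show thesis by (rule that[rotated])
qed

text \<open>
  The integer \<open>N\<close> witnesses that \<open>A + Cz\<close> is an invertible adele: its inverse is the element
  with components \<open>N / (A + C g(p))\<close>, divided by \<open>N\<close>. Nonvanishing of all components alone would
  not suffice, since infinitely many of them might fail to be units.
\<close>
lemma profinite_sim_of_int_componentsI:
  assumes "A * D - B * C \<noteq> 0" "N \<noteq> 0"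
    and dvd: "\<And>p. prime p \<Longrightarrow> A + C * g p dvd N"
    and eq: "\<And>p. prime p \<Longrightarrow> f p * (A + C * g p) = B + D * g p"
  shows "of_int_components f \<sim>\<^sub>Z of_int_components g"
proof -
  define z' z where "z' = of_int_components f" and "z = of_int_components g"
  have "(of_int A + of_int C * z) * of_int_components (\<lambda>p. N div (A + C * g p)) = of_int N"
    using dvd by (simp add: z_def of_int_components_arith of_int_components_eq_iff)
  then have "adele_of (of_int A + of_int C * z) dvd adele_of (of_int N)"
    by (metis adele_of_times dvdI)
  then have unit: "adele_of (of_int A + of_int C * z) dvd 1"
    using adele_of_int_dvd_one[OF \<open>N \<noteq> 0\<close>] by (rule dvd_trans)
  have "z' * (of_int A + of_int C * z) = of_int B + of_int D * z"
    using eq by (simp add: z_def z'_def of_int_components_arith of_int_components_eq_iff)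
  then have "adele_of z' = adele_of (of_int B + of_int D * z) / adele_of (of_int A + of_int C * z)"
    by (simp only: adele_eq_divide_iff[OF unit] flip: adele_of_times)
  moreover have "(of_int A * of_int D - of_int B * of_int C :: rat) \<noteq> 0"
    using assms(1) by (metis of_int_0_eq_iff of_int_diff of_int_mult)
  ultimately have "z' \<sim>\<^sub>Z z"
    unfolding profinite_sim_def using unit
    by (intro exI[of _ "of_int A"] exI[of _ "of_int B"] exI[of _ "of_int C"] exI[of _ "of_int D"])
       (simp add: adele_of_rat_of_int adele_of_plus adele_of_times)
  then show ?thesis by (simp only: z_def z'_def)
qed


section \<open>Reduction to the Goormaghtigh equation\<close>

lemma sim_known_solution:
  assumes "prime l"
  shows "supernat (2 ^ 4 * 5 ^ 2) * prime_infty l \<sim>\<^sub>Z supernat (2 ^ 5 * 5 ^ 3) * prime_infty l"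
proof -
  have prime5: "prime (5 :: nat)" by simp
  note mult = multiplicity_two_prime_powers[OF two_is_prime_nat prime5]
  have nz: "(2 ^ 4 * 5 ^ 2 :: nat) \<noteq> 0" "(2 ^ 5 * 5 ^ 3 :: nat) \<noteq> 0"
    by simp_all
  show ?thesis
    unfolding supernat_times_prime_infty[OF nz(1)] supernat_times_prime_infty[OF nz(2)]
  \<comment> \<open>The components of \<open>30 + z\<close> are \<open>30\<close> at \<open>l\<close> and, away from \<open>l\<close>, \<open>62\<close> at \<open>2\<close>, \<open>155\<close> at \<open>5\<close>
      and \<open>31\<close> elsewhere; all of these divide \<open>930\<close>.\<close>
  proof (rule profinite_sim_of_int_componentsI[where A = 30 and B = 0 and C = 1 and D = 31
        and N = 930])
  qed (auto simp only: mult, auto)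
qed

text \<open>
  Both sums are \<open>D / C\<close> for an integral matrix with \<open>B = 0\<close> and \<open>D = A + C\<close> that realizes the
  relation. They are not \<open>1\<close> because \<open>A \<noteq> 0\<close>, which comes from the zero components at \<open>l\<close>.
\<close>
lemma sim_imp_geometric_sums_eq:
  assumes p: "prime p" and q: "prime q" and l: "prime l" and "distinct [p, q, l]"
    and sim: "supernat (p ^ k * q ^ r) * prime_infty l \<sim>\<^sub>Z
      supernat (p ^ (k + 1) * q ^ (r + 1)) * prime_infty l"
  shows "(\<Sum>i<k + 1. p ^ i) = (\<Sum>i<r + 1. q ^ i)" "(\<Sum>i<k + 1. p ^ i) \<noteq> 1"
proof -
  have ne: "p \<noteq> q" "p \<noteq> l" "q \<noteq> l" using assms by auto
  note mult = multiplicity_two_prime_powers[OF p q _ ne(1)]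
  have nz: "p ^ i * q ^ j \<noteq> 0" for i j
    using p q by auto
  obtain A B C D :: int where det: "A * D - B * C \<noteq> 0" and
    eq: "\<And>t. prime t \<Longrightarrow>
      (if t = l then 0 else int t ^ multiplicity t (p ^ k * q ^ r)) *
      (A + C * (if t = l then 0 else int t ^ multiplicity t (p ^ (k + 1) * q ^ (r + 1)))) =
      B + D * (if t = l then 0 else int t ^ multiplicity t (p ^ (k + 1) * q ^ (r + 1)))"
    using profinite_sim_of_int_componentsD[OF sim[unfolded supernat_times_prime_infty[OF nz]]]
    by metis
  have B: "B = 0" using eq[OF l] by simp
  with det have A: "A \<noteq> 0" and D: "D \<noteq> 0" by auto
  obtain t :: nat where t: "prime t" "t > p + q + l" using bigger_prime by blast
  have "A + C = D"
    using eq[OF t(1)] t(2) by (simp add: mult[OF t(1)] B del: power_Suc)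
  have sum: "C * int (\<Sum>i<j + 1. s ^ i) = D"
    if s: "prime s" and e: "int s ^ j * (A + C * int s ^ (j + 1)) = D * int s ^ (j + 1)" for s j
  proof -
    have s1: "int s > 1" using prime_gt_1_nat[OF s] by simp
    from e have "int s ^ j * (A + C * int s ^ (j + 1)) = int s ^ j * (D * int s)"
      by simp
    then have "A + C * int s ^ (j + 1) = D * int s"
      using s1 by (subst (asm) mult_cancel_left) simp
    then have "C * (int s ^ (j + 1) - 1) = D * (int s - 1)"
      using \<open>A + C = D\<close> by (simp add: algebra_simps)
    then have "(int s - 1) * (C * (\<Sum>i<j + 1. int s ^ i)) = (int s - 1) * D"
      by (simp only: power_diff_1_eq mult_ac)
    then show ?thesis
      using s1 by (subst (asm) mult_cancel_left) simp
  qed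
  have sump: "C * int (\<Sum>i<k + 1. p ^ i) = D"
    using eq[OF p] ne by (intro sum[OF p]) (simp add: mult[OF p] B del: power_Suc)
  have sumq: "C * int (\<Sum>i<r + 1. q ^ i) = D"
    using eq[OF q] ne by (intro sum[OF q]) (simp add: mult[OF q] B del: power_Suc)
  have "C \<noteq> 0" using sump D by auto
  with sump sumq have "int (\<Sum>i<k + 1. p ^ i) = int (\<Sum>i<r + 1. q ^ i)"
    by (metis mult_cancel_left)
  then show "(\<Sum>i<k + 1. p ^ i) = (\<Sum>i<r + 1. q ^ i)"
    by (simp only: of_nat_eq_iff)
  show "(\<Sum>i<k + 1. p ^ i) \<noteq> 1"
  proof
    assume "(\<Sum>i<k + 1. p ^ i) = 1"
    with sump have "C = D" by (simp only: of_nat_1 mult_1_right)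
    with A \<open>A + C = D\<close> show False by simp
  qed
qed

text \<open>
  If \<open>r = 1\<close>, the right-hand side is \<open>1 + q\<close>, and removing \<open>1\<close> from both sides leaves a multiple
  of \<open>p\<close> equal to the prime \<open>q\<close>. If \<open>r = 0\<close>, both sums are \<open>1\<close>.
\<close>
lemma geometric_sums_eq_imp_exponent_ge_2:
  fixes p q :: nat
  assumes "prime p" "prime q" "p \<noteq> q"
    and "(\<Sum>i<k + 1. p ^ i) = (\<Sum>i<r + 1. q ^ i)" "(\<Sum>i<k + 1. p ^ i) \<noteq> 1"
  shows "2 \<le> r"
proof -
  have "r \<noteq> 0" using assms(4,5) by (auto intro!: Nat.gr0I)
  moreover have "r \<noteq> 1"
  proof
    assume "r = 1"
    then have "1 + q = (\<Sum>i<k + 1. p ^ i)" using assms(4) by simp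
    also have "\<dots> = 1 + p * (\<Sum>i<k. p ^ i)"
      by (simp add: sum.lessThan_Suc_shift sum_distrib_left del: sum.lessThan_Suc)
    finally have "p dvd q" by simp
    with assms(1-3) show False using primes_dvd_imp_eq by blast
  qed
  ultimately show ?thesis by linarith
qed

lemma geometric_sum_eq_divide:
  fixes s :: nat
  assumes "1 < s"
  shows "(rat_of_nat s ^ n - 1) / (rat_of_nat s - 1) = of_nat (\<Sum>i<n. s ^ i)"
  using assms by (simp add: power_diff_1_eq)

theorem proposition23:
  shows "(\<forall>l. prime l \<longrightarrow>
           supernat (2 ^ 4 * 5 ^ 2) * prime_infty l \<sim>\<^sub>Z supernat (2 ^ 5 * 5 ^ 3) * prime_infty l) \<and>
         (\<forall>p q l k r. prime p \<and> prime q \<and> prime l \<and> p \<le> q \<and> distinct [p, q, l] \<and>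
           (p, q, k, r) \<noteq> (2, 5, 4, 2) \<and>
           supernat (p ^ k * q ^ r) * prime_infty l \<sim>\<^sub>Z
             supernat (p ^ (k + 1) * q ^ (r + 1)) * prime_infty l \<longrightarrow>
           goormaghtigh_counterexample p q (k + 1) (r + 1))"
proof (intro conjI allI impI)
  fix p q l k r :: nat
  assume H: "prime p \<and> prime q \<and> prime l \<and> p \<le> q \<and> distinct [p, q, l] \<and>
    (p, q, k, r) \<noteq> (2, 5, 4, 2) \<and>
    supernat (p ^ k * q ^ r) * prime_infty l \<sim>\<^sub>Z
      supernat (p ^ (k + 1) * q ^ (r + 1)) * prime_infty l"
  then have p: "prime p" and q: "prime q" and ne: "p \<noteq> q" and "p < q" by auto
  from H have sums: "(\<Sum>i<k + 1. p ^ i) = (\<Sum>i<r + 1. q ^ i)" "(\<Sum>i<k + 1. p ^ i) \<noteq> 1"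
    using sim_imp_geometric_sums_eq[of p q l k r] by blast+
  have r: "2 \<le> r"
    using geometric_sums_eq_imp_exponent_ge_2[OF p q ne sums] .
  have k: "2 \<le> k"
    using geometric_sums_eq_imp_exponent_ge_2[OF q p ne[symmetric] sums(1)[symmetric]] sums by simp
  have "(rat_of_nat p ^ (k + 1) - 1) / (rat_of_nat p - 1) =
      (rat_of_nat q ^ (r + 1) - 1) / (rat_of_nat q - 1)"
    using prime_gt_1_nat[OF p] prime_gt_1_nat[OF q] by (simp only: geometric_sum_eq_divide sums(1))
  then have "goormaghtigh_solution p q (k + 1) (r + 1)"
    using prime_gt_1_nat[OF p] \<open>p < q\<close> k r by (simp add: goormaghtigh_solution_def)
  moreover have "q \<noteq> 90"
  proof
    assume "q = 90"
    then have "2 dvd q" by simp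
    with q \<open>q = 90\<close> show False using primes_dvd_imp_eq[OF two_is_prime_nat q] by simp
  qed
  ultimately show "goormaghtigh_counterexample p q (k + 1) (r + 1)"
    using H by (auto simp: goormaghtigh_counterexample_def)
qed (fact sim_known_solution)

end
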